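(* Let $X$ and $Y$ be Banach spaces and $T\in LR(X,Y)$. Then $T$ is closed if and only if $(D(T),\|\cdot\|_T)$ is a Banach space and $T(0)$ is closed.
   Context: All spaces are over the same scalar field ($\mathbf R$ or $\mathbf C$). $LR(X,Y)$ is the set of all linear subspaces of $X\times Y$. For $T\in LR(X,Y)$: $D(T)$ is its domain, $T(x)=\{y\in Y:(x,y)\in T\}$. $T$ is closed if it is closed in $X\times Y$. For $x\in D(T)$, $\|T(x)\|:=\|[y]\|$ for any $y\in T(x)$, where $[y]=y+\overline{T(0)}\in Y/\overline{T(0)}$ and $\|[y]\|=\inf\{\|y-e\|:e\in\overline{T(0)}\}$. The graph norm of $T$ is $\|x\|_T:=\|x\|+\|T(x)\|$, $x\in D(T)$. *)

theory Defs
  imports "HOL-Analysis.Analysis"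
begin

text \<open>The scalars are an arbitrary type \<open>'k\<close> of class \<^class>\<open>real_normed_field\<close>: by the
  theorems of Ostrowski and Mazur, the only such fields are, up to isometric isomorphism, the real
  and the complex numbers. The norm and topology of a normed space come from its type; the
  scalar multiplication \<open>s\<close> is an explicit parameter, since the type classes only provide real scalars.
  No link between \<open>s\<close> and \<open>scaleR\<close> has to be assumed: additivity and continuity of
  \<open>\<lambda>r. s (of_real r) x\<close> force them to agree on real scalars.\<close>

locale normed_vector_space = vector_space s
  for s :: "'k::real_normed_field \<Rightarrow> 'a::real_normed_vector \<Rightarrow> 'a" +
  assumes norm_scale: "norm (s c x) = norm c * norm x"

text \<open>A subspace \<open>V\<close> of the ambient vector space, with a norm \<open>N\<close> of its own. Only the values
  of \<open>N\<close> on \<open>V\<close> matter.\<close>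

definition normed_space_on ::
    "('k::real_normed_field \<Rightarrow> 'a::ab_group_add \<Rightarrow> 'a) \<Rightarrow> 'a set \<Rightarrow> ('a \<Rightarrow> real) \<Rightarrow> bool" where
  "normed_space_on s V N \<longleftrightarrow>
     module.subspace s V \<and>
     (\<forall>x\<in>V. 0 \<le> N x) \<and>
     (\<forall>x\<in>V. N x = 0 \<longleftrightarrow> x = 0) \<and>
     (\<forall>c. \<forall>x\<in>V. N (s c x) = norm c * N x) \<and>
     (\<forall>x\<in>V. \<forall>y\<in>V. N (x + y) \<le> N x + N y)"

text \<open>The value 0 off \<open>V\<close> is there because \<^locale>\<open>Metric_space\<close> requires a nonnegative,
  symmetric distance also outside the carrier.\<close>

definition norm_dist_on :: "'a::ab_group_add set \<Rightarrow> ('a \<Rightarrow> real) \<Rightarrow> 'a \<Rightarrow> 'a \<Rightarrow> real" where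
  "norm_dist_on V N x y = (if x \<in> V \<and> y \<in> V then N (x - y) else 0)"

definition banach_space_on ::
    "('k::real_normed_field \<Rightarrow> 'a::ab_group_add \<Rightarrow> 'a) \<Rightarrow> 'a set \<Rightarrow> ('a \<Rightarrow> real) \<Rightarrow> bool" where
  "banach_space_on s V N \<longleftrightarrow>
     normed_space_on s V N \<and> Metric_space.mcomplete V (norm_dist_on V N)"

lemma Metric_space_norm_dist_on:
  assumes "vector_space s" and "normed_space_on s V N"
  shows "Metric_space V (norm_dist_on V N)"
proof -
  interpret vector_space s by fact
  have sub: "subspace V"
    and nonneg: "\<And>x. x \<in> V \<Longrightarrow> 0 \<le> N x"
    and zero: "\<And>x. x \<in> V \<Longrightarrow> N x = 0 \<longleftrightarrow> x = 0"
    and hom: "\<And>c x. x \<in> V \<Longrightarrow> N (s c x) = norm c * N x"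
    and tri: "\<And>x y. x \<in> V \<Longrightarrow> y \<in> V \<Longrightarrow> N (x + y) \<le> N x + N y"
    using assms(2) by (simp_all add: normed_space_on_def)
  note diff = subspace_diff[OF sub]
  show ?thesis
  proof
    show "0 \<le> norm_dist_on V N x y" for x y
      by (simp add: norm_dist_on_def nonneg diff)
    show "norm_dist_on V N x y = norm_dist_on V N y x" for x y
    proof (cases "x \<in> V \<and> y \<in> V")
      case True
      then have "N (s (- 1) (y - x)) = N (y - x)"
        using hom[OF diff, of y x "- 1"] by (metis mult_1 norm_minus_cancel norm_one)
      moreover have "s (- 1) (y - x) = x - y"
        by simp
      ultimately show ?thesis
        using True unfolding norm_dist_on_def by metis
    qed (auto simp: norm_dist_on_def)
    show "norm_dist_on V N x y = 0 \<longleftrightarrow> x = y" if "x \<in> V" "y \<in> V" for x y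
      using that by (simp add: norm_dist_on_def zero diff)
    show "norm_dist_on V N x z \<le> norm_dist_on V N x y + norm_dist_on V N y z"
      if "x \<in> V" "y \<in> V" "z \<in> V" for x y z
      using that tri[OF diff diff, of x y y z] by (simp add: norm_dist_on_def)
  qed
qed

text \<open>A linear relation is identified with its graph, so that \<open>D(T)\<close> is \<^term>\<open>Domain T\<close> and
  \<open>T(x)\<close> is \<^term>\<open>T `` {x}\<close>.\<close>

definition LR ::
    "('k::field \<Rightarrow> 'a::ab_group_add \<Rightarrow> 'a) \<Rightarrow> ('k \<Rightarrow> 'b::ab_group_add \<Rightarrow> 'b) \<Rightarrow> ('a \<times> 'b) set set" where
  "LR sX sY = {T. module.subspace (module_prod.scale sX sY) T}"

text \<open>The norm of the class \<open>[y]\<close> in the quotient by \<open>E\<close>.\<close>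

definition quotient_norm :: "'b::real_normed_vector set \<Rightarrow> 'b \<Rightarrow> real" where
  "quotient_norm E y = (INF e\<in>E. norm (y - e))"

definition rel_norm :: "('a::zero \<times> 'b::real_normed_vector) set \<Rightarrow> 'a \<Rightarrow> real" where
  "rel_norm T x = quotient_norm (closure (T `` {0})) (SOME y. y \<in> T `` {x})"

definition graph_norm ::
    "('a::real_normed_vector \<times> 'b::real_normed_vector) set \<Rightarrow> 'a \<Rightarrow> real" where
  "graph_norm T x = norm x + rel_norm T x"

text \<open>On \<open>D(T)\<close>, the choice of \<open>y\<close> in \<^const>\<open>rel_norm\<close> is immaterial.\<close>

lemma rel_norm_eq:
  fixes sX :: "'k::real_normed_field \<Rightarrow> 'a::real_normed_vector \<Rightarrow> 'a"
    and sY :: "'k \<Rightarrow> 'b::real_normed_vector \<Rightarrow> 'b"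
  assumes "vector_space sX" and "vector_space sY" and "T \<in> LR sX sY" and y: "y \<in> T `` {x}"
  shows "rel_norm T x = quotient_norm (closure (T `` {0})) y"
proof -
  interpret X: vector_space sX by fact
  interpret Y: vector_space sY by fact
  interpret P: vector_space_prod sX sY ..
  have T: "P.p.subspace T"
    using assms(3) by (simp add: LR_def)
  let ?E = "T `` {0}"
  have shift: "quotient_norm (closure ?E) v \<le> quotient_norm (closure ?E) w"
    if v: "v \<in> T `` {x}" and w: "w \<in> T `` {x}" for v w
  proof -
    have vw: "v - w \<in> ?E"
      using P.p.subspace_diff[OF T, of "(x, v)" "(x, w)"] v w by simp
    have add: "e + (v - w) \<in> closure ?E" if e: "e \<in> closure ?E" for e
    proof -
      have "(\<lambda>e. e + (v - w)) ` closure ?E \<subseteq> closure ?E"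
      proof (rule image_closure_subset)
        show "continuous_on (closure ?E) (\<lambda>e. e + (v - w))"
          by (intro continuous_intros)
        have "u + (v - w) \<in> ?E" if "u \<in> ?E" for u
          using P.p.subspace_add[OF T, of "(0, u)" "(0, v - w)"] vw that by simp
        then show "(\<lambda>e. e + (v - w)) ` ?E \<subseteq> closure ?E"
          using closure_subset[of ?E] by blast
      qed simp
      then show ?thesis using e by blast
    qed
    have ne: "closure ?E \<noteq> {}"
      using vw closure_subset[of ?E] by blast
    show ?thesis
      unfolding quotient_norm_def
    proof (rule cINF_greatest[OF ne])
      fix e assume "e \<in> closure ?E"
      moreover have "bdd_below ((\<lambda>e. norm (v - e)) ` closure ?E)"
        by (rule bdd_belowI[of _ 0]) auto
      ultimately have "(INF e\<in>closure ?E. norm (v - e)) \<le> norm (v - (e + (v - w)))"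
        using add by (intro cINF_lower) auto
      then show "(INF e\<in>closure ?E. norm (v - e)) \<le> norm (w - e)"
        by simp
    qed
  qed
  have "(SOME y. y \<in> T `` {x}) \<in> T `` {x}"
    using y by (rule someI)
  then show ?thesis
    unfolding rel_norm_def using shift y by (metis order_antisym)
qed

end

theory Submission
  imports Defs
begin

text \<open>The graph norm on \<open>D(T)\<close> is the quotient norm of \<open>T / ({0} \<times> T(0))\<close>, for the norm
  \<open>\<parallel>x\<parallel> + \<parallel>y\<parallel>\<close> on \<open>T\<close>, transported along the linear bijection induced by \<open>(x, y) \<mapsto> x\<close>: indeed \<open>\<parallel>T(x)\<parallel>\<close> is the infimum of \<open>\<parallel>y\<parallel>\<close> over
  \<open>y \<in> T(x)\<close>, because \<open>T(x)\<close> is a coset of \<open>T(0)\<close> and passing to the closure of \<open>T(0)\<close> does not change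
  a distance. All that is used about \<open>\<parallel>T(x)\<parallel>\<close> is this description as an infimum, in the
  form of the lemmas \<open>rel_norm_le\<close> (it is a lower bound) and \<open>rel_norm_lessE\<close> (it is
  nearly attained). They make \<open>\<parallel>T(x)\<parallel>\<close> a seminorm on \<open>D(T)\<close>, and the summand \<open>\<parallel>x\<parallel>\<close> makes the graph norm
  definite.

  The theorem is then the familiar statement that a normed space \<open>T\<close> is complete iff a closed subspace
  and the quotient by it are, with completeness of \<open>T\<close> and of \<open>T(0)\<close> read as closedness in \<open>X \<times> Y\<close>
  and \<open>Y\<close>.

  If \<open>T\<close> is closed and \<open>x\<^sub>n\<close> is a Cauchy sequence of the graph norm, a subsequence has summable increments; near-optimal
  choices of values for the increments sum up to values \<open>y\<^sub>n \<in> T(x\<^sub>n)\<close> along the subsequence that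
  converge in \<open>Y\<close>, and the limit of the pairs \<open>(x\<^sub>n, y\<^sub>n)\<close> lies in \<open>T\<close>. Conversely,
  let \<open>(x\<^sub>n, y\<^sub>n) \<in> T\<close> converge to \<open>(x, y)\<close>. Completeness puts \<open>x\<close> into \<open>D(T)\<close>,
  with \<open>\<parallel>T(x\<^sub>n - x)\<parallel> \<longlongrightarrow> 0\<close>. Near-optimal values of \<open>T(x\<^sub>n - x)\<close> and a fixed \<open>z \<in> T(x)\<close> correct
  \<open>y\<^sub>n\<close> to a sequence in \<open>T(0)\<close> converging to \<open>y - z\<close>, so that closedness of \<open>T(0)\<close> gives
  \<open>y \<in> T(x)\<close>.\<close>

section \<open>The norm of a value of a linear relation\<close>

locale normed_linear_relation =
  X: normed_vector_space sX + Y: normed_vector_space sY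
  for sX :: "'k::real_normed_field \<Rightarrow> 'a::real_normed_vector \<Rightarrow> 'a"
    and sY :: "'k \<Rightarrow> 'b::real_normed_vector \<Rightarrow> 'b" +
  fixes T :: "('a \<times> 'b) set"
  assumes linear_relation: "T \<in> LR sX sY"
begin

sublocale P: vector_space_prod sX sY ..

lemma subspace: "P.p.subspace T"
  using linear_relation by (simp add: LR_def)

lemma zero_in: "(0, 0) \<in> T"
  using P.p.subspace_0[OF subspace] by (simp add: zero_prod_def)

lemma add_in: "(x, y) \<in> T \<Longrightarrow> (x', y') \<in> T \<Longrightarrow> (x + x', y + y') \<in> T"
  using P.p.subspace_add[OF subspace, of "(x, y)" "(x', y')"] by simp

lemma diff_in: "(x, y) \<in> T \<Longrightarrow> (x', y') \<in> T \<Longrightarrow> (x - x', y - y') \<in> T"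
  using P.p.subspace_diff[OF subspace, of "(x, y)" "(x', y')"] by simp

lemma scale_in: "(x, y) \<in> T \<Longrightarrow> (sX c x, sY c y) \<in> T"
  using P.p.subspace_scale[OF subspace, of "(x, y)" c] by (simp add: P.scale_def)

lemma subspace_Domain: "X.subspace (Domain T)"
  by (rule X.subspaceI) (auto intro: zero_in add_in scale_in)

lemma diff_in_Domain: "x \<in> Domain T \<Longrightarrow> x' \<in> Domain T \<Longrightarrow> x - x' \<in> Domain T"
  by (rule X.subspace_diff[OF subspace_Domain])

lemma rel_norm_eq_INF:
  "(x, y) \<in> T \<Longrightarrow> rel_norm T x = (INF e\<in>closure (T `` {0}). norm (y - e))"
  using rel_norm_eq[OF X.vector_space_axioms Y.vector_space_axioms linear_relation, of y x]
  by (simp add: quotient_norm_def)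

lemma zero_in_closure: "0 \<in> closure (T `` {0})"
  using zero_in closure_subset[of "T `` {0}"] by auto

lemma rel_norm_nonneg:
  assumes "x \<in> Domain T"
  shows "0 \<le> rel_norm T x"
proof -
  obtain y where "(x, y) \<in> T"
    using assms by blast
  then show ?thesis
    using zero_in_closure by (auto simp: rel_norm_eq_INF intro!: cINF_greatest)
qed

lemma rel_norm_le:
  assumes "(x, y) \<in> T"
  shows "rel_norm T x \<le> norm y"
proof -
  have "bdd_below ((\<lambda>e. norm (y - e)) ` closure (T `` {0}))"
    by (rule bdd_belowI[of _ 0]) auto
  then have "(INF e\<in>closure (T `` {0}). norm (y - e)) \<le> norm (y - 0)"
    by (rule cINF_lower[OF _ zero_in_closure])
  then show ?thesis
    using assms by (simp add: rel_norm_eq_INF)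
qed

text \<open>An element of the closure of \<open>T(0)\<close> that nearly attains the infimum can be moved into \<open>T(0)\<close> at an
  arbitrarily small cost, and subtracting it from a value at \<open>x\<close> gives another value at \<open>x\<close>.\<close>

lemma rel_norm_lessE:
  assumes "x \<in> Domain T" and less: "rel_norm T x < r"
  obtains y where "(x, y) \<in> T" and "norm y < r"
proof -
  obtain y where y: "(x, y) \<in> T"
    using assms(1) by blast
  have "\<exists>e\<in>closure (T `` {0}). norm (y - e) < r"
  proof (rule ccontr)
    assume "\<not> ?thesis"
    then have "r \<le> (INF e\<in>closure (T `` {0}). norm (y - e))"
      using zero_in_closure by (intro cINF_greatest) (auto simp: not_less)
    then show False
      using less y by (simp add: rel_norm_eq_INF)
  qed
  then obtain e where e: "e \<in> closure (T `` {0})" "norm (y - e) < r"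
    by blast
  then obtain e' where e': "(0, e') \<in> T" "dist e' e < r - norm (y - e)"
    using closure_approachable[of e "T `` {0}"] by (metis Image_singleton_iff diff_gt_0_iff_gt)
  show thesis
  proof
    show "(x, y - e') \<in> T"
      using diff_in[OF y e'(1)] by simp
    have "norm (y - e') \<le> norm (y - e) + dist e' e"
      using norm_triangle_ineq[of "y - e" "e - e'"] by (simp add: dist_norm norm_minus_commute)
    then show "norm (y - e') < r"
      using e'(2) by simp
  qed
qed

lemma rel_norm_zero: "rel_norm T 0 = 0"
  using rel_norm_le[OF zero_in] rel_norm_nonneg[of 0] zero_in by fastforce

lemma rel_norm_triangle:
  assumes x: "x \<in> Domain T" and x': "x' \<in> Domain T"
  shows "rel_norm T (x + x') \<le> rel_norm T x + rel_norm T x'"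
proof (rule field_le_epsilon)
  fix \<epsilon> :: real
  assume "0 < \<epsilon>"
  then obtain y y' where y: "(x, y) \<in> T" "norm y < rel_norm T x + \<epsilon> / 2"
    and y': "(x', y') \<in> T" "norm y' < rel_norm T x' + \<epsilon> / 2"
    using rel_norm_lessE[OF x, of "rel_norm T x + \<epsilon> / 2"]
      rel_norm_lessE[OF x', of "rel_norm T x' + \<epsilon> / 2"]
    by (metis half_gt_zero less_add_same_cancel1)
  show "rel_norm T (x + x') \<le> rel_norm T x + rel_norm T x' + \<epsilon>"
    using rel_norm_le[OF add_in[OF y(1) y'(1)]] norm_triangle_ineq[of y y'] y(2) y'(2) by linarith
qed

lemma rel_norm_scale_le:
  assumes x: "x \<in> Domain T"
  shows "rel_norm T (sX c x) \<le> norm c * rel_norm T x"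
proof (cases "c = 0")
  case False
  show ?thesis
  proof (rule field_le_epsilon)
    fix \<epsilon> :: real
    assume "0 < \<epsilon>"
    then obtain y where y: "(x, y) \<in> T" "norm y < rel_norm T x + \<epsilon> / norm c"
      using rel_norm_lessE[OF x, of "rel_norm T x + \<epsilon> / norm c"] False
      by (metis divide_pos_pos less_add_same_cancel1 zero_less_norm_iff)
    have "rel_norm T (sX c x) \<le> norm c * norm y"
      using rel_norm_le[OF scale_in[OF y(1), of c]] by (simp add: Y.norm_scale)
    also have "\<dots> \<le> norm c * (rel_norm T x + \<epsilon> / norm c)"
      using y(2) by (intro mult_left_mono) auto
    also have "\<dots> = norm c * rel_norm T x + \<epsilon>"
      using False by (simp add: distrib_left)
    finally show "rel_norm T (sX c x) \<le> norm c * rel_norm T x + \<epsilon>" .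
  qed
qed (simp add: rel_norm_zero)

lemma rel_norm_scale:
  assumes x: "x \<in> Domain T"
  shows "rel_norm T (sX c x) = norm c * rel_norm T x"
proof (cases "c = 0")
  case False
  \<comment> \<open>The other inequality is the same one for the inverse scalar.\<close>
  have "rel_norm T (sX (inverse c) (sX c x)) \<le> norm (inverse c) * rel_norm T (sX c x)"
    by (rule rel_norm_scale_le[OF X.subspace_scale[OF subspace_Domain x]])
  then have "norm c * rel_norm T x \<le> rel_norm T (sX c x)"
    using False by (simp add: norm_inverse norm_divide field_simps)
  then show ?thesis
    using rel_norm_scale_le[OF x, of c] by simp
qed (simp add: rel_norm_zero)

section \<open>The graph norm and its metric\<close>

lemma normed_space_graph_norm: "normed_space_on sX (Domain T) (graph_norm T)"
  unfolding normed_space_on_def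
proof (intro conjI ballI allI subspace_Domain)
  fix x assume x: "x \<in> Domain T"
  show "0 \<le> graph_norm T x"
    using rel_norm_nonneg[OF x] by (simp add: graph_norm_def)
  show "graph_norm T x = 0 \<longleftrightarrow> x = 0"
    using rel_norm_nonneg[OF x] rel_norm_zero
    by (auto simp: graph_norm_def add_nonneg_eq_0_iff)
  show "graph_norm T (sX c x) = norm c * graph_norm T x" for c
    by (simp add: graph_norm_def X.norm_scale rel_norm_scale[OF x] distrib_left)
  show "graph_norm T (x + x') \<le> graph_norm T x + graph_norm T x'" if "x' \<in> Domain T" for x'
    using norm_triangle_ineq[of x x'] rel_norm_triangle[OF x that] by (simp add: graph_norm_def)
qed

lemma graph_norm_le: "(x, y) \<in> T \<Longrightarrow> graph_norm T x \<le> norm x + norm y"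
  using rel_norm_le by (simp add: graph_norm_def)

lemma norm_le_graph_norm: "x \<in> Domain T \<Longrightarrow> norm x \<le> graph_norm T x"
  using rel_norm_nonneg by (simp add: graph_norm_def)

sublocale D: Metric_space "Domain T" "norm_dist_on (Domain T) (graph_norm T)"
  by (rule Metric_space_norm_dist_on[OF X.vector_space_axioms normed_space_graph_norm])

lemma graph_dist: "x \<in> Domain T \<Longrightarrow> x' \<in> Domain T \<Longrightarrow>
    norm_dist_on (Domain T) (graph_norm T) x x' = graph_norm T (x - x')"
  by (simp add: norm_dist_on_def)

lemma dist_le_graph_dist:
  "x \<in> Domain T \<Longrightarrow> x' \<in> Domain T \<Longrightarrow> dist x x' \<le> norm_dist_on (Domain T) (graph_norm T) x x'"
  using norm_le_graph_norm[OF diff_in_Domain] by (simp add: graph_dist dist_norm)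

lemma graph_dist_le:
  assumes "(x, y) \<in> T" and "(x', y') \<in> T"
  shows "norm_dist_on (Domain T) (graph_norm T) x x' \<le> dist x x' + dist y y'"
proof -
  have "x \<in> Domain T" "x' \<in> Domain T"
    using assms by blast+
  then show ?thesis
    using graph_norm_le[OF diff_in[OF assms]] by (simp add: graph_dist dist_norm)
qed

lemma limitin_graph_dist:
  "limitin D.mtopology \<sigma> x sequentially \<Longrightarrow>
    (\<lambda>n. norm_dist_on (Domain T) (graph_norm T) (\<sigma> n) x) \<longlonglongrightarrow> 0"
  by (simp add: D.limitin_metric_dist_null)

lemma graph_MCauchy_imp_Cauchy:
  assumes "D.MCauchy \<sigma>"
  shows "Cauchy \<sigma>"
proof (rule metric_CauchyI)
  fix \<epsilon> :: real
  assume "0 < \<epsilon>"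
  then obtain N where N: "\<forall>n n'. N \<le> n \<longrightarrow> N \<le> n' \<longrightarrow>
      norm_dist_on (Domain T) (graph_norm T) (\<sigma> n) (\<sigma> n') < \<epsilon>"
    using assms unfolding D.MCauchy_def by blast
  have "\<sigma> n \<in> Domain T" for n
    using assms unfolding D.MCauchy_def by blast
  then show "\<exists>M. \<forall>m\<ge>M. \<forall>n\<ge>M. dist (\<sigma> m) (\<sigma> n) < \<epsilon>"
    using N dist_le_graph_dist by (meson order_le_less_trans)
qed

lemma graph_limit_imp_tendsto:
  assumes "limitin D.mtopology \<sigma> x sequentially" and "\<And>n. \<sigma> n \<in> Domain T"
  shows "\<sigma> \<longlonglongrightarrow> x"
proof (rule metric_tendsto_imp_tendsto[OF limitin_graph_dist[OF assms(1)]])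
  have "x \<in> Domain T"
    using assms(1) by (simp add: D.limitin_metric)
  then show "\<forall>\<^sub>F n in sequentially.
      dist (\<sigma> n) x \<le> dist (norm_dist_on (Domain T) (graph_norm T) (\<sigma> n) x) 0"
    using assms(2) dist_le_graph_dist by (intro always_eventually) (simp add: D.nonneg)
qed

lemma closed_imp_closed_zero_image:
  assumes "closed T"
  shows "closed (T `` {0})"
proof -
  have "T `` {0} = Pair 0 -` T"
    by auto
  then show ?thesis
    using assms by (auto intro!: closed_vimage continuous_intros)
qed

end

section \<open>Closedness and completeness\<close>

text \<open>A Cauchy sequence converges as soon as a subsequence does, so one may assume that the increments
  have graph norm below \<open>(1/2)\<^sup>n\<close>. The increments then have values in \<open>Y\<close> of norm below \<open>(1/2)\<^sup>n\<close>.
  By completeness of \<open>Y\<close> their series converges, and its partial sums, shifted by a value at the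
  initial point, are values along the subsequence. The limit pair lies in the closed set \<open>T\<close>, and
  convergence of the pairs in \<open>X \<times> Y\<close> implies convergence in the graph norm.\<close>

lemma closed_imp_graph_norm_complete:
  fixes sX :: "'k::real_normed_field \<Rightarrow> 'a::banach \<Rightarrow> 'a"
    and sY :: "'k \<Rightarrow> 'b::banach \<Rightarrow> 'b"
  assumes "normed_linear_relation sX sY T" and closed: "closed T"
  shows "Metric_space.mcomplete (Domain T) (norm_dist_on (Domain T) (graph_norm T))"
proof -
  interpret normed_linear_relation sX sY T by fact
  show ?thesis
    unfolding D.mcomplete_def
  proof (intro allI impI)
    fix \<sigma> assume Cauchy: "D.MCauchy \<sigma>"
    then have dom: "\<sigma> n \<in> Domain T" for n
      unfolding D.MCauchy_def by blast
    have "\<exists>N. \<forall>m m'. N \<le> m \<longrightarrow> N \<le> m' \<longrightarrow>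
        norm_dist_on (Domain T) (graph_norm T) (\<sigma> m) (\<sigma> m') < (1/2) ^ n" for n
      using Cauchy unfolding D.MCauchy_def by (meson half_gt_zero zero_less_one zero_less_power)
    then obtain N where N: "\<And>n m m'. N n \<le> m \<Longrightarrow> N n \<le> m' \<Longrightarrow>
        norm_dist_on (Domain T) (graph_norm T) (\<sigma> m) (\<sigma> m') < (1/2) ^ n"
      by metis
    \<comment> \<open>The partial sums make \<open>k\<close> monotone with \<open>N n \<le> k n\<close>; the summand \<open>n\<close> makes it strictly so.\<close>
    define k where "k n = n + (\<Sum>i\<le>n. N i)" for n
    have mono: "strict_mono k"
      by (simp add: strict_mono_Suc_iff k_def)
    have "N n \<le> k n" for n
      unfolding k_def by (simp add: member_le_sum trans_le_add2)
    moreover have "k n \<le> k (Suc n)" for n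
      by (simp add: k_def)
    ultimately have step: "graph_norm T (\<sigma> (k (Suc n)) - \<sigma> (k n)) < (1/2) ^ n" for n
      using N[of n "k (Suc n)" "k n"] dom by (metis graph_dist order_trans)
    have "\<exists>u. (\<sigma> (k (Suc n)) - \<sigma> (k n), u) \<in> T \<and> norm u < (1/2) ^ n" for n
    proof -
      have "rel_norm T (\<sigma> (k (Suc n)) - \<sigma> (k n)) < (1/2) ^ n"
        using step[of n] norm_ge_zero[of "\<sigma> (k (Suc n)) - \<sigma> (k n)"]
        unfolding graph_norm_def by linarith
      then show ?thesis
        using rel_norm_lessE[OF diff_in_Domain[OF dom dom]] by metis
    qed
    then obtain u where u: "\<And>n. (\<sigma> (k (Suc n)) - \<sigma> (k n), u n) \<in> T"
      and u_less: "\<And>n. norm (u n) < (1/2) ^ n"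
      by metis
    obtain y0 where y0: "(\<sigma> (k 0), y0) \<in> T"
      using dom by blast
    define y where "y n = y0 + (\<Sum>i<n. u i)" for n
    have in_T: "(\<sigma> (k n), y n) \<in> T" for n
    proof (induction n)
      case 0
      then show ?case
        using y0 by (simp add: y_def)
    next
      case (Suc n)
      then show ?case
        using add_in[OF Suc u[of n]] by (simp add: y_def add.assoc)
    qed
    have "summable u"
      by (rule summable_comparison_test'[of "\<lambda>n. (1/2) ^ n" 0])
        (use u_less in \<open>auto intro: less_imp_le\<close>)
    then have y_lim: "y \<longlonglongrightarrow> y0 + suminf u"
      unfolding y_def by (intro tendsto_intros summable_LIMSEQ)
    obtain x where "\<sigma> \<longlonglongrightarrow> x"
      using graph_MCauchy_imp_Cauchy[OF Cauchy] Cauchy_convergent_iff convergent_def by blast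
    then have x_lim: "(\<lambda>n. \<sigma> (k n)) \<longlonglongrightarrow> x"
      using LIMSEQ_subseq_LIMSEQ[OF _ mono] by (simp add: o_def)
    have lim_in_T: "(x, y0 + suminf u) \<in> T"
      using closed_sequentially[OF closed, of "\<lambda>n. (\<sigma> (k n), y n)"] in_T
        tendsto_Pair[OF x_lim y_lim] by blast
    have "(\<lambda>n. dist (\<sigma> (k n)) x + dist (y n) (y0 + suminf u)) \<longlonglongrightarrow> 0"
      using tendsto_add[OF iffD1[OF tendsto_dist_iff x_lim] iffD1[OF tendsto_dist_iff y_lim]]
      by simp
    then have "(\<lambda>n. norm_dist_on (Domain T) (graph_norm T) (\<sigma> (k n)) x) \<longlonglongrightarrow> 0"
      by (rule Lim_null_comparison[rotated])
        (rule always_eventually, simp add: D.nonneg graph_dist_le[OF in_T lim_in_T])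
    then have "limitin D.mtopology (\<sigma> \<circ> k) x sequentially"
      using lim_in_T dom by (auto simp: D.limitin_metric_dist_null)
    then show "\<exists>x. limitin D.mtopology \<sigma> x sequentially"
      using D.MCauchy_convergent_subsequence[OF Cauchy mono] by blast
  qed
qed

text \<open>The limit \<open>x\<close> of the first components lies in \<open>D(T)\<close> because it is also the limit in the graph
  norm. What remains is to place \<open>y\<close> in \<open>T(x)\<close>, a coset of the closed space \<open>T(0)\<close>.\<close>

lemma graph_norm_complete_imp_closed:
  assumes "normed_linear_relation sX sY T"
    and complete: "Metric_space.mcomplete (Domain T) (norm_dist_on (Domain T) (graph_norm T))"
    and closed_zero: "closed (T `` {0})"
  shows "closed T"
proof -
  interpret normed_linear_relation sX sY T by fact
  have "(x, y) \<in> T" if p: "\<And>n. p n \<in> T" and lim: "p \<longlonglongrightarrow> (x, y)" for p x y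
  proof -
    define \<sigma> where "\<sigma> n = fst (p n)" for n
    define \<eta> where "\<eta> n = snd (p n)" for n
    have in_T: "(\<sigma> n, \<eta> n) \<in> T" for n
      using p by (simp add: \<sigma>_def \<eta>_def)
    then have dom: "\<sigma> n \<in> Domain T" for n
      by blast
    have \<sigma>_lim: "\<sigma> \<longlonglongrightarrow> x" and \<eta>_lim: "\<eta> \<longlonglongrightarrow> y"
      using tendsto_fst[OF lim] tendsto_snd[OF lim] by (simp_all add: \<sigma>_def[abs_def] \<eta>_def[abs_def])
    have "D.MCauchy \<sigma>"
      unfolding D.MCauchy_def
    proof (intro conjI allI impI)
      show "range \<sigma> \<subseteq> Domain T"
        using dom by blast
      fix \<epsilon> :: real
      assume "0 < \<epsilon>"
      then obtain M M' where "\<forall>m\<ge>M. \<forall>n\<ge>M. dist (\<sigma> m) (\<sigma> n) < \<epsilon> / 2"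
        and "\<forall>m\<ge>M'. \<forall>n\<ge>M'. dist (\<eta> m) (\<eta> n) < \<epsilon> / 2"
        using metric_CauchyD[OF LIMSEQ_imp_Cauchy[OF \<sigma>_lim], of "\<epsilon> / 2"]
          metric_CauchyD[OF LIMSEQ_imp_Cauchy[OF \<eta>_lim], of "\<epsilon> / 2"] by auto
      then have "norm_dist_on (Domain T) (graph_norm T) (\<sigma> m) (\<sigma> n) < \<epsilon>"
        if "max M M' \<le> m" "max M M' \<le> n" for m n
        using graph_dist_le[OF in_T[of m] in_T[of n]] that by fastforce
      then show "\<exists>N. \<forall>n n'. N \<le> n \<longrightarrow> N \<le> n' \<longrightarrow>
          norm_dist_on (Domain T) (graph_norm T) (\<sigma> n) (\<sigma> n') < \<epsilon>"
        by blast
    qed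
    then obtain x' where x': "limitin D.mtopology \<sigma> x' sequentially"
      using complete unfolding D.mcomplete_def by blast
    have "x' = x"
      by (rule LIMSEQ_unique[OF graph_limit_imp_tendsto[OF x' dom] \<sigma>_lim])
    with x' have graph_lim: "limitin D.mtopology \<sigma> x sequentially"
      by simp
    then have x: "x \<in> Domain T"
      by (simp add: D.limitin_metric)
    then obtain z where z: "(x, z) \<in> T"
      by blast
    \<comment> \<open>The slack \<open>1 / (n + 1)\<close> makes up for the infimum \<open>\<parallel>T(\<sigma> n - x)\<parallel>\<close> possibly not being attained.\<close>
    have "\<exists>u. (\<sigma> n - x, u) \<in> T \<and>
        norm u < norm_dist_on (Domain T) (graph_norm T) (\<sigma> n) x + inverse (Suc n)" for n
    proof -
      have "rel_norm T (\<sigma> n - x)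
          < norm_dist_on (Domain T) (graph_norm T) (\<sigma> n) x + inverse (Suc n)"
        unfolding graph_dist[OF dom x] graph_norm_def
        using add_nonneg_pos[OF norm_ge_zero[of "\<sigma> n - x"], of "inverse (real (Suc n))"]
        by simp
      then show ?thesis
        using rel_norm_lessE[OF diff_in_Domain[OF dom x]] by metis
    qed
    then obtain u where u: "\<And>n. (\<sigma> n - x, u n) \<in> T"
      and u_less: "\<And>n. norm (u n)
          < norm_dist_on (Domain T) (graph_norm T) (\<sigma> n) x + inverse (Suc n)"
      by metis
    have "(\<lambda>n. norm_dist_on (Domain T) (graph_norm T) (\<sigma> n) x + inverse (Suc n)) \<longlonglongrightarrow> 0"
      using tendsto_add[OF limitin_graph_dist[OF graph_lim] LIMSEQ_inverse_real_of_nat] by simp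
    then have "u \<longlonglongrightarrow> 0"
      by (rule Lim_null_comparison[rotated])
        (use u_less in \<open>auto intro!: always_eventually less_imp_le\<close>)
    then have "(\<lambda>n. \<eta> n - u n - z) \<longlonglongrightarrow> y - 0 - z"
      by (intro tendsto_intros \<eta>_lim)
    moreover have "\<eta> n - u n - z \<in> T `` {0}" for n
      using diff_in[OF diff_in[OF in_T[of n] u[of n]] z] by simp
    ultimately have "(0, y - z) \<in> T"
      using closed_sequentially[OF closed_zero, of "\<lambda>n. \<eta> n - u n - z"] by simp
    then show ?thesis
      using add_in[OF _ z] by fastforce
  qed
  then show ?thesis
    by (auto simp: closed_sequential_limits)
qed

theorem theorem4p2:
  fixes sX :: "'k::real_normed_field \<Rightarrow> 'a::banach \<Rightarrow> 'a"
    and sY :: "'k \<Rightarrow> 'b::banach \<Rightarrow> 'b"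
    and T :: "('a \<times> 'b) set"
  assumes "normed_vector_space sX" and "normed_vector_space sY"
    and "T \<in> LR sX sY"
  shows "closed T \<longleftrightarrow> banach_space_on sX (Domain T) (graph_norm T) \<and> closed (T `` {0})"
proof -
  have rel: "normed_linear_relation sX sY T"
    using assms by (simp add: normed_linear_relation_def normed_linear_relation_axioms_def)
  then interpret normed_linear_relation sX sY T .
  show ?thesis
    unfolding banach_space_on_def
    using normed_space_graph_norm closed_imp_closed_zero_image
      closed_imp_graph_norm_complete[OF rel] graph_norm_complete_imp_closed[OF rel]
    by blast
qed

end
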